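(* Every real number $r\le -\tau^{3/2}=-\sqrt{2+\sqrt5}$, where $\tau=(1+\sqrt5)/2$, is a limit point of the set of least $H$-eigenvalues of adjacency tensors of uniform hypergraphs; that is, $r$ is an accumulation point of the set $\{\lambda_{\min}(\mathcal{A}(H)) : H \text{ a uniform hypergraph}\}$.
   Context: For a $k$-uniform hypergraph $H$ on vertices $w_1,\dots,w_N$, the adjacency tensor $\mathcal{A}(H)$ is the order-$k$, dimension-$N$ tensor with entry $1/(k-1)!$ at $(i_1,\dots,i_k)$ if $\{w_{i_1},\dots,w_{i_k}\}$ is an edge and $0$ otherwise. A real $\lambda$ is an $H$-eigenvalue of $\mathcal{A}(H)$ if there is a nonzero real $x$ with $\sum_{i_2,\dots,i_k}a_{ii_2\dots i_k}x_{i_2}\cdots x_{i_k}=\lambda x_i^{k-1}$ for all $i$; $\lambda_{\min}(\mathcal{A}(H))$ is the smallest $H$-eigenvalue. *)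

theory Defs
  imports "HOL-Analysis.Analysis"
begin

text \<open>
  Vertices are labelled by \<open>{1..N}\<close>. As an edge is a set of exactly \<open>k\<close> vertices, hypergraphs
  are simple, and isolated vertices are allowed. Ordinary graphs are the case \<open>k = 2\<close>.
\<close>

definition uniform_hypergraph :: "nat \<Rightarrow> nat \<Rightarrow> nat set set \<Rightarrow> bool" where
  "uniform_hypergraph k N E \<longleftrightarrow> k \<ge> 2 \<and> N \<ge> 1 \<and> (\<forall>e\<in>E. e \<subseteq> {1..N} \<and> card e = k)"

text \<open>
  A real tensor of order \<open>k\<close> and dimension \<open>N\<close> is a function on index tuples, encoded as lists;
  only its values on lists of length \<open>k\<close> with entries in \<open>{1..N}\<close> are relevant.
\<close>

type_synonym tensor = "nat list \<Rightarrow> real"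

definition index_tuples :: "nat \<Rightarrow> nat \<Rightarrow> nat list set" where
  "index_tuples m N = {js. length js = m \<and> set js \<subseteq> {1..N}}"

text \<open>
  If all edges have \<open>k\<close> elements and \<open>js\<close> has length \<open>k\<close>, then \<open>set js \<in> E\<close> forces the entries
  of \<open>js\<close> to be distinct.
\<close>

definition adjacency_tensor :: "nat \<Rightarrow> nat set set \<Rightarrow> tensor" where
  "adjacency_tensor k E js = (if set js \<in> E then 1 / fact (k - 1) else 0)"

text \<open>A vector is a function \<open>x\<close> of which only the values on \<open>{1..N}\<close> matter.\<close>

definition H_eigenvalue :: "nat \<Rightarrow> nat \<Rightarrow> tensor \<Rightarrow> real \<Rightarrow> bool" where
  "H_eigenvalue k N a l \<longleftrightarrow>
     (\<exists>x :: nat \<Rightarrow> real. (\<exists>i\<in>{1..N}. x i \<noteq> 0) \<and>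
        (\<forall>i\<in>{1..N}. (\<Sum>js\<in>index_tuples (k - 1) N. a (i # js) * (\<Prod>j\<leftarrow>js. x j)) = l * x i ^ (k - 1)))"

text \<open>
  \<open>\<lambda>\<^sub>m\<^sub>i\<^sub>n\<close> as a relation rather than as a function, so that no value is assigned to a tensor
  without a smallest H-eigenvalue.
\<close>

definition is_least_H_eigenvalue :: "nat \<Rightarrow> nat \<Rightarrow> tensor \<Rightarrow> real \<Rightarrow> bool" where
  "is_least_H_eigenvalue k N a l \<longleftrightarrow>
     H_eigenvalue k N a l \<and> (\<forall>m. H_eigenvalue k N a m \<longrightarrow> l \<le> m)"

definition least_H_eigenvalues :: "real set" where
  "least_H_eigenvalues =
     {l. \<exists>k N E. uniform_hypergraph k N E \<and> is_least_H_eigenvalue k N (adjacency_tensor k E) l}"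

definition golden_ratio :: real where
  "golden_ratio = (1 + sqrt 5) / 2"

end

theory Submission
  imports Defs
begin

text \<open>
  Ordinary graphs (\<open>k = 2\<close>) suffice: for bipartite graphs the least eigenvalue is minus the spectral
  radius, and the radii of caterpillars are dense above \<open>sqrt (2 + sqrt 5)\<close> (Shearer). Given such an
  \<open>l\<close>, leaves are attached to an infinite path so that the eigenvector equation for \<open>l\<close> along
  the path has a positive bounded solution. For every \<open>l' < l\<close> the corresponding solution stops
  being positive somewhere, so cutting the path there gives a caterpillar with radius in \<open>{l'..<l}\<close>.
\<close>

section \<open>Least H-eigenvalues of bipartite graphs\<close>

lemma index_tuples_1: "index_tuples (Suc 0) N = (\<lambda>j. [j]) ` {1..N}"
  by (auto simp: index_tuples_def length_Suc_conv)

lemma H_eigenvalue_graph_iff: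
  "H_eigenvalue 2 N (adjacency_tensor 2 E) l \<longleftrightarrow>
     (\<exists>x. (\<exists>i\<in>{1..N}. x i \<noteq> 0) \<and>
        (\<forall>i\<in>{1..N}. (\<Sum>j\<in>{1..N}. (if {i, j} \<in> E then x j else 0)) = l * x i))"
proof -
  have "(\<Sum>js\<in>index_tuples (2 - 1) N. adjacency_tensor 2 E (i # js) * (\<Prod>j\<leftarrow>js. x j))
      = (\<Sum>j\<in>{1..N}. (if {i, j} \<in> E then x j else 0))" for x :: "nat \<Rightarrow> real" and i
  proof -
    have "(\<Sum>js\<in>index_tuples (2 - 1) N. adjacency_tensor 2 E (i # js) * (\<Prod>j\<leftarrow>js. x j))
      = (\<Sum>j\<in>{1..N}. adjacency_tensor 2 E [i, j] * x j)"
      by (simp add: index_tuples_1 sum.reindex inj_on_def)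
    also have "\<dots> = (\<Sum>j\<in>{1..N}. (if {i, j} \<in> E then x j else 0))"
      by (intro sum.cong) (auto simp: adjacency_tensor_def)
    finally show ?thesis .
  qed
  then show ?thesis
    unfolding H_eigenvalue_def by simp
qed

text \<open>
  Flipping the sign of \<open>y\<close> on one colour class gives the eigenvalue \<open>-l\<close>; pairing the absolute
  values of any other eigenvector with \<open>y\<close> shows that no eigenvalue exceeds \<open>l\<close> in modulus.
\<close>

lemma bipartite_least_H_eigenvalue:
  fixes y :: "nat \<Rightarrow> real"
  assumes N: "N \<ge> 1"
    and col: "\<And>i j. {i, j} \<in> E \<Longrightarrow> c i \<noteq> (c j :: bool)"
    and pos: "\<And>i. i \<in> {1..N} \<Longrightarrow> y i > 0"
    and eig: "\<And>i. i \<in> {1..N} \<Longrightarrow> (\<Sum>j\<in>{1..N}. (if {i, j} \<in> E then y j else 0)) = l * y i"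
  shows "is_least_H_eigenvalue 2 N (adjacency_tensor 2 E) (- l)"
  unfolding is_least_H_eigenvalue_def
proof (intro conjI allI impI)
  define z where "z i = (if c i then y i else - y i)" for i
  have "(\<Sum>j\<in>{1..N}. (if {i, j} \<in> E then z j else 0)) = - l * z i" if i: "i \<in> {1..N}" for i
  proof -
    have "(\<Sum>j\<in>{1..N}. (if {i, j} \<in> E then z j else 0))
        = (\<Sum>j\<in>{1..N}. (if c i then - 1 else 1) * (if {i, j} \<in> E then y j else 0))"
      by (intro sum.cong refl) (use col in \<open>auto simp: z_def\<close>)
    also have "\<dots> = - l * z i"
      by (simp only: sum_distrib_left[symmetric] eig[OF i]) (simp add: z_def)
    finally show ?thesis .
  qed
  moreover have "z 1 \<noteq> 0" "1 \<in> {1..N}"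
    using pos[of 1] N by (auto simp: z_def)
  ultimately show "H_eigenvalue 2 N (adjacency_tensor 2 E) (- l)"
    unfolding H_eigenvalue_graph_iff by blast
next
  fix m assume "H_eigenvalue 2 N (adjacency_tensor 2 E) m"
  then obtain x where x0: "\<exists>i\<in>{1..N}. x i \<noteq> 0"
    and x: "\<And>i. i \<in> {1..N} \<Longrightarrow> (\<Sum>j\<in>{1..N}. (if {i, j} \<in> E then x j else 0)) = m * x i"
    unfolding H_eigenvalue_graph_iff by blast
  define P where "P = (\<Sum>i\<in>{1..N}. y i * \<bar>x i\<bar>)"
  from x0 obtain k where k: "k \<in> {1..N}" "x k \<noteq> 0" by blast
  have "P > 0"
    unfolding P_def
    by (rule sum_pos2[OF _ k(1)]) (use k pos in \<open>auto simp: less_imp_le\<close>)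
  have "\<bar>m\<bar> * P = (\<Sum>i\<in>{1..N}. y i * \<bar>m * x i\<bar>)"
    unfolding P_def by (simp add: sum_distrib_left abs_mult algebra_simps)
  also have "\<dots> \<le> (\<Sum>i\<in>{1..N}. y i * (\<Sum>j\<in>{1..N}. (if {i, j} \<in> E then \<bar>x j\<bar> else 0)))"
  proof (intro sum_mono mult_left_mono)
    fix i assume i: "i \<in> {1..N}"
    have "\<bar>m * x i\<bar> \<le> (\<Sum>j\<in>{1..N}. \<bar>if {i, j} \<in> E then x j else 0\<bar>)"
      unfolding x[OF i, symmetric] by (rule sum_abs)
    also have "\<dots> = (\<Sum>j\<in>{1..N}. (if {i, j} \<in> E then \<bar>x j\<bar> else 0))"
      by (intro sum.cong) auto
    finally show "\<bar>m * x i\<bar> \<le> \<dots>" .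
    show "0 \<le> y i" using pos[OF i] by simp
  qed
  also have "\<dots> = (\<Sum>i\<in>{1..N}. \<Sum>j\<in>{1..N}. \<bar>x j\<bar> * (if {j, i} \<in> E then y i else 0))"
    unfolding sum_distrib_left by (intro sum.cong) (auto simp: insert_commute)
  also have "\<dots> = (\<Sum>j\<in>{1..N}. \<Sum>i\<in>{1..N}. \<bar>x j\<bar> * (if {j, i} \<in> E then y i else 0))"
    by (rule sum.swap)
  also have "\<dots> = (\<Sum>j\<in>{1..N}. \<bar>x j\<bar> * (l * y j))"
    by (intro sum.cong refl) (simp only: sum_distrib_left[symmetric] eig)
  also have "\<dots> = l * P"
    unfolding P_def by (simp add: sum_distrib_left algebra_simps)
  finally have "\<bar>m\<bar> \<le> l" using \<open>P > 0\<close> by simp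
  then show "- l \<le> m" by linarith
qed

text \<open>Relabelling along a bijection with \<open>{1..N}\<close> frees the vertex type, so that
  caterpillars can have pairs as vertices.\<close>

lemma bipartite_graph_least_H_eigenvalue:
  fixes V :: "'a set" and y :: "'a \<Rightarrow> real"
  assumes V: "finite V" "V \<noteq> {}"
    and sym: "\<And>u v. adj u v \<Longrightarrow> adj v u"
    and col: "\<And>u v. adj u v \<Longrightarrow> c u \<noteq> (c v :: bool)"
    and pos: "\<And>v. v \<in> V \<Longrightarrow> y v > 0"
    and eig: "\<And>u. u \<in> V \<Longrightarrow> (\<Sum>v\<in>{v \<in> V. adj u v}. y v) = l * y u"
  shows "- l \<in> least_H_eigenvalues"
proof -
  define N where "N = card V"
  have N: "N \<ge> 1" using V by (simp add: N_def Suc_le_eq card_gt_0_iff)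
  obtain g where g: "bij_betw g {1..N} V"
    using V(1) finite_same_card_bij[of "{1..N}" V] by (auto simp: N_def)
  define E where "E = {{i, j} |i j. i \<in> {1..N} \<and> j \<in> {1..N} \<and> adj (g i) (g j)}"
  have E_iff: "{i, j} \<in> E \<longleftrightarrow> i \<in> {1..N} \<and> j \<in> {1..N} \<and> adj (g i) (g j)" for i j
    unfolding E_def using sym by (auto simp: doubleton_eq_iff)
  have "uniform_hypergraph 2 N E"
    unfolding uniform_hypergraph_def
  proof (intro conjI ballI)
    fix e assume "e \<in> E"
    then obtain i j where e: "e = {i, j}" "i \<in> {1..N}" "j \<in> {1..N}" "adj (g i) (g j)"
      unfolding E_def by blast
    then have "i \<noteq> j" using col by blast
    with e show "e \<subseteq> {1..N}" "card e = 2" by auto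
  qed (use N in auto)
  moreover have "is_least_H_eigenvalue 2 N (adjacency_tensor 2 E) (- l)"
  proof (rule bipartite_least_H_eigenvalue[where c = "c \<circ> g" and y = "y \<circ> g"])
    fix i assume i: "i \<in> {1..N}"
    then have gi: "g i \<in> V" using g by (auto simp: bij_betw_def)
    then show "(y \<circ> g) i > 0" using pos by simp
    have "(\<Sum>j\<in>{1..N}. (if {i, j} \<in> E then (y \<circ> g) j else 0))
        = (\<Sum>j\<in>{1..N}. (if adj (g i) (g j) then y (g j) else 0))"
      by (intro sum.cong) (use i in \<open>auto simp: E_iff\<close>)
    also have "\<dots> = (\<Sum>v\<in>V. (if adj (g i) v then y v else 0))"
      by (rule sum.reindex_bij_betw[OF g])
    also have "\<dots> = l * (y \<circ> g) i"
      using eig[OF gi] by (simp add: sum.inter_filter[OF V(1)])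
    finally show "(\<Sum>j\<in>{1..N}. (if {i, j} \<in> E then (y \<circ> g) j else 0)) = l * (y \<circ> g) i" .
  qed (use N col in \<open>auto simp: E_iff\<close>)
  ultimately show ?thesis
    unfolding least_H_eigenvalues_def by blast
qed

section \<open>Caterpillars\<close>

text \<open>
  The spine entries of an eigenvector, for the eigenvalue \<open>l\<close>, of the caterpillar with spine
  \<open>1, \<dots>, n\<close> and \<open>m i\<close> leaves at \<open>i\<close>: a leaf at \<open>i\<close> carries the value \<open>spine l m i / l\<close>, and the
  equation at the last spine vertex says \<open>spine l m (n + 1) = 0\<close>.
\<close>

fun spine :: "real \<Rightarrow> (nat \<Rightarrow> nat) \<Rightarrow> nat \<Rightarrow> real" where
  "spine l m 0 = 0"
| "spine l m (Suc 0) = 1"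
| "spine l m (Suc (Suc i)) = (l - m (Suc i) / l) * spine l m (Suc i) - spine l m i"

lemma caterpillar_least_H_eigenvalue:
  assumes l: "l > 0" and n: "n \<ge> 1"
    and pos: "\<And>i. 1 \<le> i \<Longrightarrow> i \<le> n \<Longrightarrow> spine l m i > 0"
    and last: "spine l m (Suc n) = 0"
  shows "- l \<in> least_H_eigenvalues"
proof -
  \<comment> \<open>\<open>(i, 0)\<close> is the spine vertex \<open>i\<close>; the
    \<open>(i, b)\<close> with \<open>b > 0\<close> are its leaves.\<close>
  define V where "V = Sigma {1..n} (\<lambda>i. {..m i})"
  define adj where "adj u v \<longleftrightarrow>
      (snd u = 0 \<and> snd v = 0 \<and> (fst u = Suc (fst v) \<or> fst v = Suc (fst u))) \<or>
      (fst u = fst v \<and> (snd u = 0) \<noteq> (snd v = 0))" for u v :: "nat \<times> nat"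
  define c where "c u = (even (fst u) = (snd u = 0))" for u :: "nat \<times> nat"
  define y where "y u = (if snd u = 0 then spine l m (fst u) else spine l m (fst u) / l)"
    for u :: "nat \<times> nat"
  show ?thesis
  proof (rule bipartite_graph_least_H_eigenvalue[where V = V and adj = adj and c = c and y = y])
    show "finite V" by (simp add: V_def)
    have "(1, 0) \<in> V" using n by (simp add: V_def)
    then show "V \<noteq> {}" by blast
    show "adj v u" if "adj u v" for u v using that by (auto simp: adj_def)
    show "c u \<noteq> c v" if "adj u v" for u v using that by (auto simp: adj_def c_def)
    show "y v > 0" if "v \<in> V" for v using that pos l by (auto simp: V_def y_def)
    fix u assume u: "u \<in> V"
    then obtain i b where ib: "u = (i, b)" "1 \<le> i" "i \<le> n" "b \<le> m i"
      by (auto simp: V_def)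
    show "(\<Sum>v\<in>{v \<in> V. adj u v}. y v) = l * y u"
    proof (cases "b = 0")
      case False
      then have "{v \<in> V. adj u v} = {(i, 0)}"
        using ib by (auto simp: V_def adj_def)
      then show ?thesis using False ib l by (simp add: y_def)
    next
      case True
      \<comment> \<open>The ends of the spine lack a neighbour; \<open>spine l m 0 = 0\<close> and
        \<open>last\<close> make the missing terms zero.\<close>
      define S1 where "S1 = (if i = 1 then {} else {(i - 1, 0::nat)})"
      define S2 where "S2 = (if i = n then {} else {(i + 1, 0::nat)})"
      define S3 where "S3 = Pair i ` {1..m i}"
      have split: "{v \<in> V. adj u v} = (S1 \<union> S2) \<union> S3"
        using ib True by (auto simp: V_def adj_def S1_def S2_def S3_def)
      have "sum y (S1 \<union> S2 \<union> S3) = sum y (S1 \<union> S2) + sum y S3"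
        by (rule sum.union_disjoint) (auto simp: S1_def S2_def S3_def)
      also have "sum y (S1 \<union> S2) = sum y S1 + sum y S2"
        by (rule sum.union_disjoint) (auto simp: S1_def S2_def)
      also have "sum y S1 = spine l m (i - 1)"
        by (simp add: S1_def y_def)
      also have "sum y S2 = spine l m (Suc i)"
        using last by (simp add: S2_def y_def)
      also have "sum y S3 = m i * spine l m i / l"
        by (simp add: S3_def sum.reindex inj_on_def y_def)
      finally have "sum y {v \<in> V. adj u v} =
          spine l m (i - 1) + spine l m (Suc i) + m i * spine l m i / l"
        unfolding split .
      moreover obtain i' where "i = Suc i'" using ib by (cases i) auto
      ultimately show ?thesis
        using ib True by (simp add: y_def algebra_simps)
    qed
  qed
qed

section \<open>Wronskian comparison of the spines for two parameters\<close>

text \<open>Discrete Lagrange identity: a step of the recurrence changes the Wronskian by the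
  difference of the coefficients \<open>l - m j / l\<close> and \<open>l' - m j / l'\<close>, times
  the product of the entries.\<close>

lemma spine_wronskian:
  "spine l m (Suc i) * spine l' m i - spine l m i * spine l' m (Suc i)
     = (\<Sum>j=1..i. ((l - l') + m j * (1 / l' - 1 / l)) * (spine l m j * spine l' m j))"
proof (induction i)
  case (Suc i)
  have "spine l m (Suc (Suc i)) * spine l' m (Suc i) - spine l m (Suc i) * spine l' m (Suc (Suc i))
      = (spine l m (Suc i) * spine l' m i - spine l m i * spine l' m (Suc i))
        + ((l - l') + m (Suc i) * (1 / l' - 1 / l)) * (spine l m (Suc i) * spine l' m (Suc i))"
    by (simp add: algebra_simps)
  then show ?case using Suc by simp
qed simp

lemma spine_wronskian_ge:
  assumes l: "0 < l'" "l' \<le> l"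
    and nonneg: "\<And>j. 1 \<le> j \<Longrightarrow> j \<le> i \<Longrightarrow> spine l m j * spine l' m j \<ge> 0"
  shows "(l - l') * (\<Sum>j=1..i. spine l m j * spine l' m j)
    \<le> spine l m (Suc i) * spine l' m i - spine l m i * spine l' m (Suc i)"
  unfolding spine_wronskian sum_distrib_left
proof (intro sum_mono mult_right_mono)
  fix j assume "j \<in> {1..i}"
  then show "spine l m j * spine l' m j \<ge> 0" using nonneg by simp
  have "1 / l' - 1 / l \<ge> 0" using l by (simp add: frac_le)
  then show "l - l' \<le> (l - l') + m j * (1 / l' - 1 / l)" by simp
qed

text \<open>Sturm comparison: a nonnegative Wronskian means that the ratio of the entries at
  \<open>l\<close> to those at \<open>l'\<close>, initially 1, never decreases.\<close>

lemma spine_pos_mono: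
  assumes l: "0 < l'" "l' \<le> l"
    and pos: "\<And>i. 1 \<le> i \<Longrightarrow> i \<le> n \<Longrightarrow> spine l' m i > 0"
    and i: "1 \<le> i" "i \<le> n"
  shows "spine l m i > 0"
  using i
proof (induction i rule: less_induct)
  case (less i)
  show ?case
  proof (cases "i = 1")
    case False
    then obtain k where k: "i = Suc k" "1 \<le> k"
      using less.prems by (cases i) auto
    have ge: "spine l m j * spine l' m j \<ge> 0" if "1 \<le> j" "j \<le> k" for j
      using less.IH[of j] pos[of j] that k less.prems by simp
    have "0 \<le> (l - l') * (\<Sum>j=1..k. spine l m j * spine l' m j)"
      by (rule mult_nonneg_nonneg[OF _ sum_nonneg]) (use l ge in auto)
    also have "\<dots> \<le> spine l m i * spine l' m k - spine l m k * spine l' m i"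
      unfolding k(1) by (rule spine_wronskian_ge[OF l ge])
    finally have "spine l m k * spine l' m i \<le> spine l m i * spine l' m k" by simp
    moreover have "spine l m k * spine l' m i > 0"
      using less.IH[of k] pos[of i] k less.prems by simp
    moreover have "spine l' m k > 0" using pos k less.prems by simp
    ultimately show ?thesis by (metis less_le_trans zero_less_mult_pos2)
  qed simp
qed

lemma continuous_on_spine: "continuous_on {0<..} (\<lambda>l. spine l m i)"
proof (induction i rule: less_induct)
  case (less i)
  consider "i = 0" | "i = 1" | k where "i = Suc (Suc k)"
    by (metis One_nat_def not0_implies_Suc)
  then show ?case
  proof cases
    case 3
    then show ?thesis
      using less.IH[of k] less.IH[of "Suc k"] by (auto intro!: continuous_intros)
  qed auto
qed

text \<open>At the first index \<open>k\<close> whose entry at \<open>l'\<close> is nonpositive, the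
  entry at \<open>l\<close> is positive, so it vanishes for some \<open>s\<close> in between. The
  earlier entries are positive at \<open>l'\<close>, hence at \<open>s\<close>, and cutting the
  spine before \<open>k\<close> gives a caterpillar with eigenvalue \<open>s\<close>.\<close>

lemma caterpillar_value_between:
  assumes l: "0 < l'" "l' < l"
    and pos: "\<And>i. i \<ge> 1 \<Longrightarrow> spine l m i > 0"
    and ex: "\<exists>i\<ge>1. spine l' m i \<le> 0"
  shows "\<exists>s. l' \<le> s \<and> s < l \<and> - s \<in> least_H_eigenvalues"
proof -
  define k where "k = (LEAST i. i \<ge> 1 \<and> spine l' m i \<le> 0)"
  have k: "k \<ge> 1" "spine l' m k \<le> 0"
    using LeastI_ex[of "\<lambda>i. i \<ge> 1 \<and> spine l' m i \<le> 0"] ex unfolding k_def by auto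
  have least: "spine l' m i > 0" if "1 \<le> i" "i < k" for i
    using not_less_Least[of i "\<lambda>i. i \<ge> 1 \<and> spine l' m i \<le> 0"] that unfolding k_def by force
  have "k \<noteq> 1" using k by auto
  then obtain n where n: "k = Suc n" "n \<ge> 1" using k by (cases k) auto
  have "\<exists>s\<ge>l'. s \<le> l \<and> spine s m k = 0"
  proof (rule IVT')
    show "continuous_on {l'..l} (\<lambda>s. spine s m k)"
      by (rule continuous_on_subset[OF continuous_on_spine]) (use l in auto)
  qed (use k pos[of k] l in auto)
  then obtain s where s: "l' \<le> s" "s \<le> l" "spine s m k = 0" by blast
  have "s \<noteq> l" using s pos[of k] k by auto
  moreover have "- s \<in> least_H_eigenvalues"
  proof (rule caterpillar_least_H_eigenvalue[where n = n])
    show "spine s m i > 0" if "1 \<le> i" "i \<le> n" for i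
      by (rule spine_pos_mono[OF l(1) s(1) _ that]) (use least n in auto)
  qed (use s n l in auto)
  ultimately show ?thesis using s by force
qed

text \<open>
  If the entries stayed positive at \<open>l'\<close> as well, the Wronskian would bound the sum of the
  squares of the entries at \<open>l\<close>, while forcing these entries to stay away from \<open>0\<close>.
\<close>

lemma spine_bounded_imp_nonpos_below:
  assumes l: "0 < l'" "l' < l"
    and pos: "\<And>i. i \<ge> 1 \<Longrightarrow> spine l m i > 0"
    and bdd: "\<And>i. i \<ge> 1 \<Longrightarrow> spine l m i \<le> C"
  shows "\<exists>i\<ge>1. spine l' m i \<le> 0"
proof (rule ccontr)
  assume "\<not> ?thesis"
  then have pos': "spine l' m i > 0" if "i \<ge> 1" for i using that by force
  define x where "x = spine l m"
  define x' where "x' = spine l' m"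
  define e where "e = l - l'"
  have e: "e > 0" using l by (simp add: e_def)
  have xp: "x i > 0" "x' i > 0" "x i \<le> C" if "i \<ge> 1" for i
    using pos pos' bdd that by (auto simp: x_def x'_def)
  have C: "C \<ge> 1" using bdd[of 1] by simp
  have W: "e * (\<Sum>j=1..i. x j * x' j) \<le> x (Suc i) * x' i - x i * x' (Suc i)" for i
    unfolding x_def x'_def e_def
    by (rule spine_wronskian_ge) (use l pos pos' in \<open>auto simp: less_imp_le\<close>)
  have step: "x i * x' (Suc i) \<le> x (Suc i) * x' i" if "i \<ge> 1" for i
  proof -
    have "0 \<le> e * (\<Sum>j=1..i. x j * x' j)"
      using e xp by (intro mult_nonneg_nonneg sum_nonneg) (auto simp: less_imp_le)
    with W[of i] show ?thesis by linarith
  qed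
  have ratio: "x' i / x i \<le> x' j / x j" if "1 \<le> j" "j \<le> i" for i j
    using that(2)
  proof (induction rule: dec_induct)
    case (step k)
    have "x' (Suc k) / x (Suc k) \<le> x' k / x k"
      using xp[of k] xp[of "Suc k"] \<open>\<And>i. i \<ge> 1 \<Longrightarrow> x i * x' (Suc i) \<le> x (Suc i) * x' i\<close>[of k]
        step that by (simp add: field_simps)
    then show ?case using step by linarith
  qed simp
  \<comment> \<open>As \<open>x' / x\<close> is nonincreasing, \<open>x' j\<close> is at least
    \<open>x j\<close> times the last ratio \<open>x' i / x i\<close>; this factor then cancels,
    leaving only entries at \<open>l\<close>.\<close>
  have S: "e * (\<Sum>j=1..i. (x j)\<^sup>2) \<le> x (Suc i) * x i" if i: "i \<ge> 1" for i
  proof -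
    have "(x' i / x i) * (e * (\<Sum>j=1..i. (x j)\<^sup>2)) = e * (\<Sum>j=1..i. (x j)\<^sup>2 * (x' i / x i))"
      by (simp add: sum_distrib_left algebra_simps)
    also have "\<dots> \<le> e * (\<Sum>j=1..i. x j * x' j)"
    proof (intro mult_left_mono sum_mono)
      fix j assume j: "j \<in> {1..i}"
      have "(x j)\<^sup>2 * (x' i / x i) \<le> (x j)\<^sup>2 * (x' j / x j)"
        using ratio[of j i] j by (intro mult_left_mono) auto
      also have "\<dots> = x j * x' j" using xp[of j] j by (simp add: power2_eq_square)
      finally show "(x j)\<^sup>2 * (x' i / x i) \<le> x j * x' j" .
    qed (use e in simp)
    also have "\<dots> \<le> x (Suc i) * x' i - x i * x' (Suc i)" by (rule W)
    also have "\<dots> \<le> x (Suc i) * x' i"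
      using xp[of i] xp[of "Suc i"] i by simp
    also have "\<dots> = (x' i / x i) * (x (Suc i) * x i)"
      using xp[of i] i by simp
    finally show ?thesis
      by (rule mult_left_le_imp_le) (use xp[of i] i in simp)
  qed
  have low: "x i \<ge> e / C" if i: "i \<ge> 1" for i
  proof -
    have "(x 1)\<^sup>2 \<le> (\<Sum>j=1..i. (x j)\<^sup>2)"
      by (rule member_le_sum) (use i in auto)
    then have "e * 1 \<le> e * (\<Sum>j=1..i. (x j)\<^sup>2)"
      using e by (intro mult_left_mono) (auto simp: x_def)
    also have "\<dots> \<le> x (Suc i) * x i" by (rule S[OF i])
    also have "\<dots> \<le> C * x i"
      using xp[of i] xp[of "Suc i"] i by (intro mult_right_mono) auto
    finally show ?thesis using C by (simp add: field_simps)
  qed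
  \<comment> \<open>By \<open>low\<close>, the sum of squares in \<open>S\<close> grows at least
    linearly in \<open>i\<close>, while its right side is at most \<open>C * C\<close>.\<close>
  have bound: "real i * (e * (e / C)\<^sup>2) \<le> C * C" if i: "i \<ge> 1" for i
  proof -
    have "real i * (e * (e / C)\<^sup>2) = e * (\<Sum>j=1..i. (e / C)\<^sup>2)" by simp
    also have "\<dots> \<le> e * (\<Sum>j=1..i. (x j)\<^sup>2)"
      using e low C by (intro mult_left_mono sum_mono power_mono) auto
    also have "\<dots> \<le> x (Suc i) * x i" by (rule S[OF i])
    also have "\<dots> \<le> C * C"
      using xp[of i] xp[of "Suc i"] i C by (intro mult_mono) auto
    finally show ?thesis .
  qed
  have "e * (e / C)\<^sup>2 > 0" using e C by simp
  then obtain i :: nat where "C * C < real i * (e * (e / C)\<^sup>2)"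
    using reals_Archimedean3 by blast
  moreover have "0 \<le> C * C" by simp
  ultimately have "i \<ge> 1" by (cases i) auto
  with bound \<open>C * C < _\<close> show False by fastforce
qed

section \<open>Choosing the leaf numbers\<close>

text \<open>Leaves lower a ratio in steps of \<open>1 / l\<close>, the length of the target
  interval. The witness is the largest integer strictly below \<open>(y - c) * l\<close>.\<close>

lemma ex_nat_diff_in_interval:
  fixes y c l :: real
  assumes "l > 0" "y > c"
  shows "\<exists>m::nat. c < y - m / l \<and> y - m / l \<le> c + 1 / l"
proof -
  define m where "m = nat (\<lceil>(y - c) * l\<rceil> - 1)"
  have "(y - c) * l > 0" using assms by simp
  then have "real m = real_of_int \<lceil>(y - c) * l\<rceil> - 1" by (simp add: m_def)
  then have "real m < (y - c) * l" "(y - c) * l \<le> real m + 1"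
    by linarith+
  then have "real m / l < y - c" "y - c \<le> (real m + 1) / l"
    using assms by (simp_all add: pos_divide_less_eq pos_le_divide_eq)
  then have "c < y - m / l \<and> y - m / l \<le> c + 1 / l"
    by (simp add: add_divide_distrib)
  then show ?thesis by blast
qed

text \<open>The ratio \<open>q\<close> of consecutive entries becomes
  \<open>l - 1 / q - k / l\<close> when the next vertex has \<open>k\<close> leaves. If
  \<open>k\<close> can always be chosen to keep the ratio in \<open>{c<..T}\<close>, dependent
  choice yields the whole leaf sequence. \<open>R\<close> restricts the leaf numbers from the second
  vertex on.\<close>

lemma spine_ratios_exist:
  assumes c: "c > 0"
    and start: "\<exists>k. c < l - real k / l \<and> l - real k / l \<le> T"
    and step: "\<And>q. c < q \<Longrightarrow> q \<le> T \<Longrightarrow>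
      \<exists>k. c < l - 1 / q - real k / l \<and> l - 1 / q - real k / l \<le> T \<and> R k"
  shows "\<exists>m. \<forall>i\<ge>1. spine l m i > 0 \<and>
    c * spine l m i < spine l m (Suc i) \<and> spine l m (Suc i) \<le> T * spine l m i \<and> R (m (Suc i))"
proof -
  define P where "P f \<longleftrightarrow> c < snd f \<and> snd f \<le> T" for f :: "nat \<times> real"
  define Q where "Q f f' \<longleftrightarrow> snd f' = l - 1 / snd f - real (fst f') / l \<and> R (fst f')"
    for f f' :: "nat \<times> real"
  obtain k where k: "c < l - real k / l" "l - real k / l \<le> T" using start by blast
  \<comment> \<open>\<open>f n\<close> pairs the leaf number of vertex \<open>n + 1\<close> with the
    ratio there; the first vertex has no predecessor, hence no term \<open>1 / q\<close>.\<close>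
  have "\<exists>f. \<forall>n. (P (f n) \<and> (n = 0 \<longrightarrow> snd (f n) = l - real (fst (f n)) / l)) \<and> Q (f n) (f (Suc n))"
  proof (rule dependent_nat_choice[where P = "\<lambda>n f. P f \<and> (n = 0 \<longrightarrow> snd f = l - real (fst f) / l)"
        and Q = "\<lambda>_. Q"])
    show "\<exists>f. P f \<and> (0 = (0::nat) \<longrightarrow> snd f = l - real (fst f) / l)"
      using k by (intro exI[of _ "(k, l - real k / l)"]) (simp add: P_def)
    fix f :: "nat \<times> real" and n :: nat
    assume "P f \<and> (n = 0 \<longrightarrow> snd f = l - real (fst f) / l)"
    then obtain k where "c < l - 1 / snd f - real k / l \<and> l - 1 / snd f - real k / l \<le> T \<and> R k"
      using step[of "snd f"] by (auto simp: P_def)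
    then show "\<exists>f'. (P f' \<and> (Suc n = 0 \<longrightarrow> snd f' = l - real (fst f') / l)) \<and> Q f f'"
      by (intro exI[of _ "(k, l - 1 / snd f - real k / l)"]) (simp add: P_def Q_def)
  qed
  then obtain f where P: "\<And>n. P (f n)" and f0: "snd (f 0) = l - real (fst (f 0)) / l"
    and Q: "\<And>n. Q (f n) (f (Suc n))" by blast
  define m where "m i = fst (f (i - 1))" for i
  have pos: "snd (f n) > 0" for n using P[of n] c by (simp add: P_def)
  have *: "spine l m (Suc n) > 0 \<and> spine l m (Suc (Suc n)) = snd (f n) * spine l m (Suc n)" for n
  proof (induction n)
    case 0
    then show ?case by (simp add: f0 m_def)
  next
    case (Suc n)
    have "spine l m (Suc (Suc n)) > 0" using Suc pos[of n] by simp
    moreover have "spine l m (Suc n) = spine l m (Suc (Suc n)) / snd (f n)"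
      using Suc pos[of n] by simp
    then have "spine l m (Suc (Suc (Suc n))) =
        (l - m (Suc (Suc n)) / l - 1 / snd (f n)) * spine l m (Suc (Suc n))"
      by (simp only: spine.simps(3)[of l m "Suc n"] left_diff_distrib times_divide_eq_left mult_1_left)
    moreover have "l - m (Suc (Suc n)) / l - 1 / snd (f n) = snd (f (Suc n))"
      using Q[of n] by (simp add: Q_def m_def)
    ultimately show ?case by simp
  qed
  show ?thesis
  proof (intro exI[of _ m] allI impI)
    fix i :: nat assume "i \<ge> 1"
    then obtain n where n: "i = Suc n" by (cases i) auto
    show "spine l m i > 0 \<and> c * spine l m i < spine l m (Suc i)
      \<and> spine l m (Suc i) \<le> T * spine l m i \<and> R (m (Suc i))"
      using *[of n] P[of n] Q[of n] by (simp add: n P_def Q_def m_def)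
  qed
qed

text \<open>
  For large \<open>l\<close> the leaf numbers can keep every ratio of consecutive spine entries in
  \<open>{1 - 1 / l<..1}\<close>.
\<close>

lemma spine_bounded_large:
  assumes l: "l > 0" "l - 1 / l > 2"
  shows "\<exists>m. \<forall>i\<ge>1. spine l m i > 0 \<and> spine l m i \<le> 1"
proof -
  define c where "c = 1 - 1 / l"
  have sq: "l * (l - 2) > 1" using l by (simp add: field_simps)
  have l2: "l > 2" using l by (smt (verit) divide_pos_pos)
  then have c: "c > 0" by (simp add: c_def)
  \<comment> \<open>This makes the numerator of \<open>l * c - c * c - 1\<close> positive, so that a
    leafless step from a ratio above \<open>c\<close> stays above \<open>c\<close>.\<close>
  have "1 < (l - 1) * (l * (l - 2))"
    using mult_strict_mono[of 1 "l - 1" 1 "l * (l - 2)"] sq l2 by simp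
  moreover have "l * c - c * c - 1 = ((l - 1) * (l * (l - 2)) - 1) / (l * l)"
    using l by (simp add: c_def field_simps)
  ultimately have "l * c - c * c - 1 > 0" using l by simp
  then have "c * c + 1 < l * c" by linarith
  then have cc: "l - 1 / c > c" using c by (simp add: field_simps)
  have "\<exists>m. \<forall>i\<ge>1. spine l m i > 0 \<and> c * spine l m i < spine l m (Suc i) \<and>
      spine l m (Suc i) \<le> 1 * spine l m i \<and> True"
  proof (rule spine_ratios_exist[OF c, where R = "\<lambda>_. True"])
    have "c < l" using l2 l by (simp add: c_def) (smt (verit) divide_pos_pos)
    then show "\<exists>k. c < l - real k / l \<and> l - real k / l \<le> 1"
      using ex_nat_diff_in_interval[of l c l] l by (simp add: c_def)
    fix q assume q: "c < q" "q \<le> (1::real)"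
    have "1 / q < 1 / c" using q c by (simp add: frac_less2)
    then have "c < l - 1 / q" using cc by linarith
    then show "\<exists>k. c < l - 1 / q - real k / l \<and> l - 1 / q - real k / l \<le> 1 \<and> True"
      using ex_nat_diff_in_interval[of l c "l - 1 / q"] l by (simp add: c_def)
  qed
  then obtain m where m: "\<And>i. i \<ge> 1 \<Longrightarrow> spine l m i > 0 \<and> spine l m (Suc i) \<le> spine l m i"
    by auto
  have "spine l m i \<le> 1" if "i \<ge> 1" for i
    using that
  proof (induction rule: dec_induct)
    case (step k)
    then show ?case using m[of k] by simp
  qed simp
  with m show ?thesis by blast
qed

text \<open>
  For small \<open>l\<close> the ratios exceed \<open>1\<close> now and then. Boundedness comes instead from the form
  \<open>l x y - x\<^sup>2 - y\<^sup>2\<close> in consecutive entries \<open>x, y\<close>: it is invariant under a step without leaf, and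
  does not increase under a step with one leaf as long as the previous ratio is at most
  \<open>T = 2 / (l - 1 / l)\<close>. The form is positive on the cone \<open>c x \<le> y \<le> T x\<close> with
  \<open>c = T - 1 / l\<close> exactly when \<open>l\<^sup>4 - 4 l\<^sup>2 - 1 > 0\<close>.
\<close>

lemma spine_bounded_small:
  assumes l: "l > 0" "l - 1 / l \<le> 2" and quart: "l ^ 4 - 4 * l\<^sup>2 - 1 > 0"
  shows "\<exists>m C. \<forall>i\<ge>1. spine l m i > 0 \<and> spine l m i \<le> C"
proof -
  define L where "L = l\<^sup>2"
  have quart': "L * L - 4 * L - 1 > 0" using quart by (simp add: L_def power4_eq_xxxx power2_eq_square mult.assoc)
  have L0: "L > 0" using l by (simp add: L_def)
  have L1: "L > 1"
  proof (rule ccontr)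
    assume "\<not> L > 1"
    then have "L * L \<le> 1 * L" using L0 by (intro mult_right_mono) auto
    with quart' L0 show False by linarith
  qed
  define T where "T = 2 * l / (L - 1)"
  define c where "c = (L + 1) / (l * (L - 1))"
  have T0: "T > 0" using l L1 by (simp add: T_def)
  have c0: "c > 0" using l L1 by (simp add: c_def)
  have cT: "c = T - 1 / l"
    using l L1 by (simp add: c_def T_def L_def field_simps power2_eq_square)
  have TT: "l - 1 / l = 2 / T"
    using l L1 by (simp add: T_def L_def field_simps power2_eq_square)
  have "2 / T \<le> 2" using TT l by simp
  then have "T \<ge> 1" using T0 by (simp add: field_simps)
  then have T1: "1 / T \<le> T"
    by (smt (verit) divide_le_eq_1)
  \<comment> \<open>The form at \<open>(x, y)\<close> is
    \<open>g (y / x) * x\<^sup>2\<close>.\<close>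
  define g where "g q = l * q - q * q - 1" for q
  have "g T = (L * L - 4 * L - 1) / ((L - 1) * (L - 1))"
    using L1 unfolding g_def T_def
    by (simp add: divide_simps) (simp add: L_def algebra_simps power2_eq_square)
  then have gT: "g T > 0" using quart' L1 by simp
  have "g c = (L * L - 4 * L - 1) / (L * (L - 1) * (L - 1))"
    using L1 l unfolding g_def c_def
    by (simp add: divide_simps) (simp add: L_def algebra_simps power2_eq_square)
  then have gc: "g c > 0" using quart' L1 by simp
  have cc: "l - 1 / c > c" using gc c0 by (simp add: g_def field_simps)
  define h where "h = min (g c) (g T)"
  have h0: "h > 0" using gc gT by (simp add: h_def)
  \<comment> \<open>\<open>g\<close> is concave, so on the interval it is at least its smaller
    endpoint value.\<close>
  have gh: "g q \<ge> h" if q: "c < q" "q \<le> T" for q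
  proof (cases "q + c \<le> l")
    case True
    have "g q - g c = (q - c) * (l - q - c)" by (simp add: g_def algebra_simps)
    moreover have "(q - c) * (l - q - c) \<ge> 0" using q True by simp
    ultimately show ?thesis by (simp add: h_def)
  next
    case False
    have "g q - g T = (T - q) * (q + T - l)" by (simp add: g_def algebra_simps)
    moreover have "(T - q) * (q + T - l) \<ge> 0" using q False by simp
    ultimately show ?thesis by (simp add: h_def)
  qed
  have "\<exists>m. \<forall>i\<ge>1. spine l m i > 0 \<and> c * spine l m i < spine l m (Suc i) \<and>
      spine l m (Suc i) \<le> T * spine l m i \<and> m (Suc i) \<le> 1"
  proof (rule spine_ratios_exist[OF c0, where R = "\<lambda>k. k \<le> 1"])
    have "1 / c > 0" using c0 by simp
    then have "c < l" using cc by linarith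
    then show "\<exists>k. c < l - real k / l \<and> l - real k / l \<le> T"
      using ex_nat_diff_in_interval[of l c l] l by (simp add: cT)
    fix q assume q: "c < q" "q \<le> T"
    have "1 / q < 1 / c" using q c0 by (simp add: frac_less2)
    then have low: "c < l - 1 / q" using cc by linarith
    have "1 / T \<le> 1 / q" using q c0 by (simp add: frac_le)
    \<comment> \<open>One leaf suffices: the new ratio is at most
      \<open>2 / T - 1 / T = 1 / T\<close>, and \<open>T \<ge> 1\<close> because
      \<open>l - 1 / l \<le> 2\<close>.\<close>
    then have up: "l - 1 / q - 1 / l \<le> T" using TT T1 by (simp add: algebra_simps)
    show "\<exists>k. c < l - 1 / q - real k / l \<and> l - 1 / q - real k / l \<le> T \<and> k \<le> 1"
    proof (cases "l - 1 / q \<le> T")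
      case True
      then show ?thesis using low by (intro exI[of _ 0]) simp
    next
      case False
      then show ?thesis using up by (intro exI[of _ 1]) (simp add: cT)
    qed
  qed
  then obtain m where m: "\<And>i. i \<ge> 1 \<Longrightarrow> spine l m i > 0"
    "\<And>i. i \<ge> 1 \<Longrightarrow> c * spine l m i < spine l m (Suc i)"
    "\<And>i. i \<ge> 1 \<Longrightarrow> spine l m (Suc i) \<le> T * spine l m i"
    "\<And>i. i \<ge> 1 \<Longrightarrow> m (Suc i) \<le> 1" by blast
  define F where "F x y = l * x * y - x * x - y * y" for x y
  define e where "e i = F (spine l m i) (spine l m (Suc i))" for i
  have dec: "e (Suc i) \<le> e i" if i: "i \<ge> 1" for i
  proof -
    define x y where "x = spine l m i" and "y = spine l m (Suc i)"
    have xy: "x > 0" "y > 0" "y \<le> T * x"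
      using m(1)[of i] m(1)[of "Suc i"] m(3)[of i] i by (auto simp: x_def y_def)
    have next_eq: "spine l m (Suc (Suc i)) = (l - m (Suc i) / l) * y - x"
      by (simp add: x_def y_def)
    consider "m (Suc i) = 0" | "m (Suc i) = 1" using m(4)[OF i] by linarith
    then show ?thesis
    proof cases
      case 1
      then show ?thesis
        by (simp add: e_def next_eq flip: x_def y_def) (simp add: F_def algebra_simps)
    next
      case 2
      have "2 / T * y \<le> 2 * x" using xy T0 by (simp add: field_simps)
      then have "(l - 1 / l) * y \<le> 2 * x" by (simp add: TT)
      then have "(y / l) * ((l - 1 / l) * y - 2 * x) \<le> 0"
        using xy l by (intro mult_nonneg_nonpos) auto
      moreover have "F y ((l - 1 / l) * y - x) - F x y = (y / l) * ((l - 1 / l) * y - 2 * x)"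
        using l by (simp add: F_def field_simps)
      ultimately show ?thesis
        using 2 by (simp add: e_def next_eq flip: x_def y_def)
    qed
  qed
  have e1: "e i \<le> e 1" if "i \<ge> 1" for i
    using that
  proof (induction rule: dec_induct)
    case (step k)
    then show ?case using dec[of k] by simp
  qed simp
  have "spine l m i \<le> 1 + e 1 / h" if i: "i \<ge> 1" for i
  proof -
    define x y where "x = spine l m i" and "y = spine l m (Suc i)"
    have xy: "x > 0" "c * x < y" "y \<le> T * x"
      using m(1)[of i] m(2,3)[of i] i by (auto simp: x_def y_def)
    then have "h * (x * x) \<le> g (y / x) * (x * x)"
      by (intro mult_right_mono gh) (auto simp: field_simps)
    also have "\<dots> = e i"
      using xy unfolding e_def x_def[symmetric] y_def[symmetric]
      by (simp add: F_def g_def field_simps)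
    also have "\<dots> \<le> e 1" by (rule e1[OF i])
    finally have "x * x \<le> e 1 / h" using h0 by (simp add: field_simps)
    moreover have "x \<le> 1 + x * x"
      using zero_le_power2[of "x - 1 / 2"] by (simp add: power2_eq_square algebra_simps)
    ultimately show ?thesis by (simp add: x_def)
  qed
  with m(1) show ?thesis by blast
qed

section \<open>Density of the caterpillar values and limit points\<close>

lemma least_H_eigenvalue_between:
  assumes l: "0 < l'" "l' < l" and quart: "l ^ 4 - 4 * l\<^sup>2 - 1 > 0"
  shows "\<exists>s. l' \<le> s \<and> s < l \<and> - s \<in> least_H_eigenvalues"
proof -
  have "l > 0" using l by linarith
  then obtain m C where m: "\<And>i. i \<ge> 1 \<Longrightarrow> spine l m i > 0" "\<And>i. i \<ge> 1 \<Longrightarrow> spine l m i \<le> C"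
    using spine_bounded_large[of l] spine_bounded_small[of l] quart by (meson not_le)
  show ?thesis
    by (rule caterpillar_value_between[OF l m(1) spine_bounded_imp_nonpos_below[OF l m]])
qed

lemma golden_ratio_powr: "golden_ratio powr (3 / 2) = sqrt (2 + sqrt 5)"
proof -
  have pos: "golden_ratio > 0" by (simp add: golden_ratio_def add_pos_pos)
  have "golden_ratio ^ 3 = 2 + sqrt 5"
    by (simp add: golden_ratio_def power3_eq_cube field_simps)
  moreover have "golden_ratio powr (3 / 2) = (golden_ratio powr 3) powr (1 / 2)"
    by (simp add: powr_powr)
  ultimately show ?thesis
    using pos by (simp add: powr_half_sqrt)
qed

theorem theorem4p2:
  shows "- (golden_ratio powr (3 / 2)) = - sqrt (2 + sqrt 5) \<and>
         (\<forall>r::real. r \<le> - (golden_ratio powr (3 / 2)) \<longrightarrow> r islimpt least_H_eigenvalues)"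
proof (intro conjI allI impI)
  show "- (golden_ratio powr (3 / 2)) = - sqrt (2 + sqrt 5)"
    by (simp add: golden_ratio_powr)
  fix r :: real assume "r \<le> - (golden_ratio powr (3 / 2))"
  then have r: "- r \<ge> sqrt (2 + sqrt 5)" by (simp add: golden_ratio_powr)
  have pos: "sqrt (2 + sqrt 5) > 0" by (simp add: add_pos_pos)
  show "r islimpt least_H_eigenvalues"
    unfolding islimpt_approachable
  proof (intro allI impI)
    fix e :: real assume e: "e > 0"
    \<comment> \<open>The \<open>s\<close> found below lies in
      \<open>{- r + e / 4..<- r + e / 2}\<close>, so \<open>- s\<close> is within \<open>e\<close>
      of \<open>r\<close> but distinct from it.\<close>
    define l where "l = - r + e / 2"
    have l: "l > sqrt (2 + sqrt 5)" using r e by (simp add: l_def)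
    then have "l\<^sup>2 > (sqrt (2 + sqrt 5))\<^sup>2"
      using pos by (intro power_strict_mono) auto
    then have "l\<^sup>2 - 2 > sqrt 5" by simp
    \<comment> \<open>The quartic equals \<open>(l\<^sup>2 - 2)\<^sup>2 - 5\<close>; this is where
      the threshold \<open>sqrt (2 + sqrt 5)\<close> enters.\<close>
    then have "(l\<^sup>2 - 2)\<^sup>2 > (sqrt 5)\<^sup>2"
      by (intro power_strict_mono) auto
    then have "l ^ 4 - 4 * l\<^sup>2 - 1 > 0"
      by (simp add: power2_eq_square power4_eq_xxxx algebra_simps)
    then obtain s where s: "- r + e / 4 \<le> s" "s < l" "- s \<in> least_H_eigenvalues"
      using least_H_eigenvalue_between[of "- r + e / 4" l] r e pos by (auto simp: l_def)
    then have "- s \<noteq> r" "dist (- s) r < e" using e by (auto simp: l_def dist_real_def)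
    with s(3) show "\<exists>x'\<in>least_H_eigenvalues. x' \<noteq> r \<and> dist x' r < e" by blast
  qed
qed

end
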